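(* Let $\mathcal{A}\subseteq\mathbb{N}^n$ be a finite set, and let $\mathcal{B}$ be a monomial basis for $\mathcal{A}$. Then $\mathrm{SDSOS}(\mathcal{A})\subseteq\Sigma_1(\mathcal{A})$.
   Context: $\mathbb{N}=\{0,1,2,\ldots\}$; $\mathbb{R}[\mathbf{x}]=\mathbb{R}[x_1,\ldots,x_n]$; $\mathbf{x}^{\alpha}=x_1^{\alpha_1}\cdots x_n^{\alpha_n}$. The support of $f=\sum_\alpha f_\alpha\mathbf{x}^\alpha$ is $\mathrm{supp}(f)=\{\alpha: f_\alpha\neq0\}$. For finite $\mathcal{A}\subseteq\mathbb{N}^n$, $\mathscr{P}(\mathcal{A})=\{f\in\mathbb{R}[\mathbf{x}]:\mathrm{supp}(f)\subseteq\mathcal{A}\}$. $\mathbb{N}^n_d=\{\alpha\in\mathbb{N}^n:\sum_i\alpha_i\le d\}$. For finite $\mathcal{C}\subseteq\mathbb{N}^n$, $\mathbf{x}^{\mathcal{C}}$ is the column vector of the monomials $\mathbf{x}^\beta$, $\beta\in\mathcal{C}$. Monomial basis: a finite set $\mathcal{B}\subseteq\mathbb{N}^n$ of exponents, which is either $\mathcal{B}=\frac12\mathrm{conv}(\mathcal{A})\cap\mathbb{N}^n$ (Newton polytope method) or the standard basis $\mathcal{B}=\mathbb{N}^n_d$ with $\mathcal{A}\subseteq\mathbb{N}^n_{2d}$. Put $r=|\mathcal{B}|$; $r\times r$ matrices have rows and columns indexed by $\mathcal{B}$. $\mathbb{S}^r_+$ is the set of real symmetric positive semidefinite $r\times r$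 matrices. For a symmetric binary ($\{0,1\}$-valued) matrix $B$, $\mathbb{S}^r_+(B)=\{Q\in\mathbb{S}^r_+: B\circ Q=Q\}$, where $\circ$ is the entrywise product. Block-closure: for a symmetric binary matrix $B$, $\overline{B}$ is the binary matrix whose set of positions of nonzero entries is the transitive closure of the relation $\{(i,j):B_{ij}=1\}$. Define $[C_{\mathcal{A}}^{(1)}]_{\beta\gamma}=1$ if $\beta+\gamma\in\mathcal{A}\cup2\mathcal{B}$ (with $2\mathcal{B}=\{2\beta:\beta\in\mathcal{B}\}$) and $0$ otherwise, for $\beta,\gamma\in\mathcal{B}$, and $B_{\mathcal{A}}^{(1)}=\overline{C_{\mathcal{A}}^{(1)}}$. $\Sigma(\mathcal{A})=\{f\in\mathscr{P}(\mathcal{A}):\exists Q\in\mathbb{S}^r_+\text{ with }f=(\mathbf{x}^{\mathcal{B}})^TQ\mathbf{x}^{\mathcal{B}}\}$ and $\Sigma_1(\mathcal{A})=\{f\in\mathscr{P}(\mathcal{A}):\exists Q\in\mathbb{S}^r_+(B_{\mathcal{A}}^{(1)})\text{ with }f=(\mathbf{x}^{\mathcal{B}})^TQ\mathbf{x}^{\mathcal{B}}\}$. A real symmetric matrix $Q$ is diagonally dominant if $Q_{ii}\ge\sum_{j\ne i}|Q_{ij}|$ for all $i$, and scaled diagonally dominant if there is a positive definite diagonal matrix $D$ such that $DQD$ is diagonally dominant. A polynomial $f\in\mathscr{P}(\mathbb{N}^n_{2d})$ is an SDSOS polynomial if $f=(\mathbf{x}^{\mathbb{N}^n_d})^TQ\mathbf{x}^{\mathbb{N}^n_d}$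 for some scaled diagonally dominant symmetric matrix $Q$ indexed by $\mathbb{N}^n_d$. $\mathrm{SDSOS}(\mathcal{A})$ is the set of SDSOS polynomials belonging to $\Sigma(\mathcal{A})$. *)

theory Defs
  imports "HOL-Analysis.Analysis" "HOL-Library.Poly_Mapping"
begin

section \<open>Polynomials in n variables\<close>

text \<open>
  Exponents are elements of \<^typ>\<open>nat ^ 'n\<close>, the number of variables being the cardinality of the
  index type. Polynomials are finitely supported maps from exponents to coefficients, with the
  convolution product of \<^theory>\<open>HOL-Library.Poly_Mapping\<close>; the support of a polynomial is
  \<^const>\<open>Poly_Mapping.keys\<close>.
\<close>

type_synonym 'n expo = "nat ^ 'n"
type_synonym 'n rpoly = "(nat ^ 'n) \<Rightarrow>\<^sub>0 real"

definition monomial :: "'n::finite expo \<Rightarrow> 'n rpoly" where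
  "monomial \<alpha> = Poly_Mapping.single \<alpha> 1"

definition const_poly :: "real \<Rightarrow> 'n::finite rpoly" where
  "const_poly c = Poly_Mapping.single 0 c"

definition polys_supported :: "'n::finite expo set \<Rightarrow> 'n rpoly set" where
  "polys_supported A = {f. Poly_Mapping.keys f \<subseteq> A}"

definition expos_upto :: "nat \<Rightarrow> 'n::finite expo set" where
  "expos_upto d = {\<alpha>. (\<Sum>i\<in>UNIV. \<alpha> $ i) \<le> d}"

definition real_expo :: "'n::finite expo \<Rightarrow> real ^ 'n" where
  "real_expo \<alpha> = (\<chi> i. real (\<alpha> $ i))"

definition newton_basis :: "'n::finite expo set \<Rightarrow> 'n expo set" where
  "newton_basis A = {\<beta>. real_expo \<beta> \<in> (\<lambda>x. (1/2) *\<^sub>R x) ` (convex hull (real_expo ` A))}"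

definition monomial_basis :: "'n::finite expo set \<Rightarrow> 'n expo set \<Rightarrow> bool" where
  "monomial_basis A B \<longleftrightarrow>
     B = newton_basis A \<or> (\<exists>d. A \<subseteq> expos_upto (2 * d) \<and> B = expos_upto d)"

section \<open>Matrices indexed by a finite set\<close>

text \<open>
  A matrix with rows and columns indexed by a finite set \<open>I\<close> is a function of two indices of which
  only the values on \<open>I \<times> I\<close> are relevant; all conditions below are restricted to \<open>I\<close>.
\<close>

definition symmetric_on :: "'i set \<Rightarrow> ('i \<Rightarrow> 'i \<Rightarrow> real) \<Rightarrow> bool" where
  "symmetric_on I Q \<longleftrightarrow> (\<forall>i\<in>I. \<forall>j\<in>I. Q i j = Q j i)"

definition psd_matrices :: "'i set \<Rightarrow> ('i \<Rightarrow> 'i \<Rightarrow> real) set" where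
  "psd_matrices I =
     {Q. symmetric_on I Q \<and> (\<forall>v :: 'i \<Rightarrow> real. 0 \<le> (\<Sum>i\<in>I. \<Sum>j\<in>I. v i * Q i j * v j))}"

definition psd_matrices_pattern ::
    "'i set \<Rightarrow> ('i \<Rightarrow> 'i \<Rightarrow> real) \<Rightarrow> ('i \<Rightarrow> 'i \<Rightarrow> real) set" where
  "psd_matrices_pattern I M = {Q \<in> psd_matrices I. \<forall>i\<in>I. \<forall>j\<in>I. M i j * Q i j = Q i j}"

definition block_closure :: "'i set \<Rightarrow> ('i \<Rightarrow> 'i \<Rightarrow> real) \<Rightarrow> 'i \<Rightarrow> 'i \<Rightarrow> real" where
  "block_closure I M i j =
     (if (i, j) \<in> {(k, l). k \<in> I \<and> l \<in> I \<and> M k l = 1}\<^sup>+ then 1 else 0)"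

definition diag_dominant :: "'i set \<Rightarrow> ('i \<Rightarrow> 'i \<Rightarrow> real) \<Rightarrow> bool" where
  "diag_dominant I Q \<longleftrightarrow>
     symmetric_on I Q \<and> (\<forall>i\<in>I. Q i i \<ge> (\<Sum>j\<in>I - {i}. \<bar>Q i j\<bar>))"

text \<open>
  The function \<open>D\<close> lists the diagonal entries of the positive definite diagonal scaling matrix.
\<close>

definition scaled_diag_dominant :: "'i set \<Rightarrow> ('i \<Rightarrow> 'i \<Rightarrow> real) \<Rightarrow> bool" where
  "scaled_diag_dominant I Q \<longleftrightarrow>
     symmetric_on I Q \<and>
     (\<exists>D :: 'i \<Rightarrow> real. (\<forall>i\<in>I. D i > 0) \<and> diag_dominant I (\<lambda>i j. D i * Q i j * D j))"

section \<open>Sums of squares, term sparsity and SDSOS polynomials\<close>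

definition gram_poly :: "'n::finite expo set \<Rightarrow> ('n expo \<Rightarrow> 'n expo \<Rightarrow> real) \<Rightarrow> 'n rpoly" where
  "gram_poly B Q = (\<Sum>\<beta>\<in>B. \<Sum>\<gamma>\<in>B. monomial \<beta> * const_poly (Q \<beta> \<gamma>) * monomial \<gamma>)"

definition tsp_matrix ::
    "'n::finite expo set \<Rightarrow> 'n expo set \<Rightarrow> 'n expo \<Rightarrow> 'n expo \<Rightarrow> real" where
  "tsp_matrix A B \<beta> \<gamma> = (if \<beta> + \<gamma> \<in> A \<union> (\<lambda>\<delta>. 2 *s \<delta>) ` B then 1 else 0)"

text \<open>
  The sets \<open>\<Sigma>(A)\<close>, \<open>\<Sigma>\<^sub>1(A)\<close> and \<open>SDSOS(A)\<close> depend on the chosen monomial basis \<open>B\<close>, which is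
  therefore an explicit argument.
\<close>

definition Sigma_sos :: "'n::finite expo set \<Rightarrow> 'n expo set \<Rightarrow> 'n rpoly set" where
  "Sigma_sos A B = {f \<in> polys_supported A. \<exists>Q \<in> psd_matrices B. f = gram_poly B Q}"

definition Sigma1_sos :: "'n::finite expo set \<Rightarrow> 'n expo set \<Rightarrow> 'n rpoly set" where
  "Sigma1_sos A B =
     {f \<in> polys_supported A.
        \<exists>Q \<in> psd_matrices_pattern B (block_closure B (tsp_matrix A B)). f = gram_poly B Q}"

text \<open>
  The degree bound \<open>d\<close> is any one for which the polynomial has degree at most \<open>2 * d\<close>; in
  particular it is not tied to the basis \<open>B\<close> used for \<open>\<Sigma>(A)\<close>.
\<close>

definition sdsos_poly :: "'n::finite rpoly \<Rightarrow> bool" where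
  "sdsos_poly f \<longleftrightarrow>
     (\<exists>d. f \<in> polys_supported (expos_upto (2 * d)) \<and>
          (\<exists>Q. scaled_diag_dominant (expos_upto d) Q \<and> f = gram_poly (expos_upto d) Q))"

definition SDSOS :: "'n::finite expo set \<Rightarrow> 'n expo set \<Rightarrow> 'n rpoly set" where
  "SDSOS A B = {f \<in> Sigma_sos A B. sdsos_poly f}"

end

theory Submission
  imports Defs
begin

text \<open>
  Let \<open>Q\<close> be a scaled diagonally dominant Gram matrix of \<open>f\<close>, and let \<open>S\<close> be the set of exponents
  with nonzero diagonal entry. An extreme point \<open>v\<close> of \<open>conv S\<close> is a midpoint of elements of \<open>S\<close> only
  trivially, so the coefficient of \<open>f\<close> at \<open>2 v\<close> is \<open>Q v v\<close>, which is nonzero. By Krein-Milman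
  \<open>2 conv S\<close> lies in the convex hull of the support of \<open>f\<close>, so \<open>S\<close> lies in the monomial basis and \<open>Q\<close>
  may be reindexed by it. Setting the entries at positions \<open>(\<beta>, \<gamma>)\<close> with \<open>\<beta> + \<gamma>\<close> outside
  \<open>A \<union> 2 B\<close> to zero keeps the represented polynomial, since its coefficients there vanish, and keeps
  scaled diagonal dominance, since only off-diagonal entries are affected.
\<close>

section \<open>Diagonally dominant matrices\<close>

text \<open>The inequality of arithmetic and geometric means, weighted by
  \<open>\<bar>M i j\<bar>\<close>, bounds each off-diagonal term of the quadratic form from below.
  By symmetry these bounds add up to \<open>- T\<close>, and dominance bounds \<open>T\<close> by
  the diagonal part.\<close>

lemma diag_dominant_imp_psd:
  assumes fin: "finite I" and dd: "diag_dominant I M"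
  shows "M \<in> psd_matrices I"
proof -
  have sym: "M i j = M j i" if "i \<in> I" "j \<in> I" for i j
    using dd that by (auto simp: diag_dominant_def symmetric_on_def)
  have "0 \<le> (\<Sum>i\<in>I. \<Sum>j\<in>I. w i * M i j * w j)" for w
  proof -
    define T where "T = (\<Sum>i\<in>I. \<Sum>j\<in>I - {i}. \<bar>M i j\<bar> * (w i)\<^sup>2)"
    have remove: "(\<Sum>j\<in>I - {i}. g j) = (\<Sum>j\<in>I. g j) - g i" if "i \<in> I" for i and g :: "_ \<Rightarrow> real"
      using fin that by (simp add: sum_diff1)
    \<comment> \<open>The inner index set depends on \<open>i\<close>, so the sum is completed to
      the full square \<open>I \<times> I\<close> before swapping, and the diagonal is removed again
      afterwards.\<close>
    have T_swap: "(\<Sum>i\<in>I. \<Sum>j\<in>I - {i}. \<bar>M i j\<bar> * (w j)\<^sup>2) = T"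
    proof -
      have "(\<Sum>i\<in>I. \<Sum>j\<in>I - {i}. \<bar>M i j\<bar> * (w j)\<^sup>2)
          = (\<Sum>i\<in>I. \<Sum>j\<in>I. \<bar>M i j\<bar> * (w j)\<^sup>2) - (\<Sum>i\<in>I. \<bar>M i i\<bar> * (w i)\<^sup>2)"
        by (simp add: remove sum_subtractf cong: sum.cong)
      also have "(\<Sum>i\<in>I. \<Sum>j\<in>I. \<bar>M i j\<bar> * (w j)\<^sup>2) = (\<Sum>i\<in>I. \<Sum>j\<in>I. \<bar>M i j\<bar> * (w i)\<^sup>2)"
        by (subst sum.swap) (intro sum.cong refl, metis sym)
      also have "\<dots> - (\<Sum>i\<in>I. \<bar>M i i\<bar> * (w i)\<^sup>2) = T"
        unfolding T_def by (simp add: remove sum_subtractf cong: sum.cong)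
      finally show ?thesis .
    qed
    have young: "- (\<bar>M i j\<bar> * (w i)\<^sup>2 + \<bar>M i j\<bar> * (w j)\<^sup>2) / 2 \<le> w i * M i j * w j" for i j
    proof -
      have "2 * \<bar>w i * w j\<bar> \<le> (w i)\<^sup>2 + (w j)\<^sup>2"
        using sum_squares_bound[of "\<bar>w i\<bar>" "\<bar>w j\<bar>"] by (simp add: abs_mult)
      then have "\<bar>M i j\<bar> * (2 * \<bar>w i * w j\<bar>) \<le> \<bar>M i j\<bar> * ((w i)\<^sup>2 + (w j)\<^sup>2)"
        by (intro mult_left_mono) auto
      moreover have "\<bar>w i * M i j * w j\<bar> = \<bar>M i j\<bar> * \<bar>w i * w j\<bar>"
        by (simp add: abs_mult)
      ultimately show ?thesis
        by (simp add: algebra_simps abs_le_iff)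
    qed
    have "T \<le> (\<Sum>i\<in>I. M i i * (w i)\<^sup>2)"
      unfolding T_def sum_distrib_right[symmetric]
      using dd by (intro sum_mono mult_right_mono) (auto simp: diag_dominant_def)
    moreover have "- T = (\<Sum>i\<in>I. \<Sum>j\<in>I - {i}. - (\<bar>M i j\<bar> * (w i)\<^sup>2 + \<bar>M i j\<bar> * (w j)\<^sup>2) / 2)"
      using T_swap
      by (simp add: sum.distrib sum_negf sum_divide_distrib[symmetric] T_def[symmetric] sum_subtractf)
    moreover have "\<dots> \<le> (\<Sum>i\<in>I. \<Sum>j\<in>I - {i}. w i * M i j * w j)"
      by (intro sum_mono young)
    moreover have "(\<Sum>i\<in>I. \<Sum>j\<in>I. w i * M i j * w j)
        = (\<Sum>i\<in>I. M i i * (w i)\<^sup>2) + (\<Sum>i\<in>I. \<Sum>j\<in>I - {i}. w i * M i j * w j)"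
      by (simp add: remove sum_subtractf power2_eq_square mult_ac cong: sum.cong)
    ultimately show ?thesis by linarith
  qed
  then show ?thesis
    using dd by (auto simp: psd_matrices_def diag_dominant_def)
qed

lemma scaled_diag_dominant_imp_psd:
  assumes fin: "finite I" and sdd: "scaled_diag_dominant I Q"
  shows "Q \<in> psd_matrices I"
proof -
  obtain D where pos: "\<forall>i\<in>I. D i > 0" and dd: "diag_dominant I (\<lambda>i j. D i * Q i j * D j)"
    using sdd by (auto simp: scaled_diag_dominant_def)
  have "0 \<le> (\<Sum>i\<in>I. \<Sum>j\<in>I. v i * Q i j * v j)" for v
  proof -
    \<comment> \<open>Evaluating the form of the scaled matrix at \<open>v i / D i\<close> cancels
      the scaling.\<close>
    have "0 \<le> (\<Sum>i\<in>I. \<Sum>j\<in>I. v i / D i * (D i * Q i j * D j) * (v j / D j))"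
      using diag_dominant_imp_psd[OF fin dd] unfolding psd_matrices_def
      by (auto dest!: spec[of _ "\<lambda>i. v i / D i"])
    also have "\<dots> = (\<Sum>i\<in>I. \<Sum>j\<in>I. v i * Q i j * v j)"
      using pos by (intro sum.cong refl) (force simp: field_simps)
    finally show ?thesis .
  qed
  then show ?thesis
    using sdd by (auto simp: psd_matrices_def scaled_diag_dominant_def)
qed

text \<open>A zero diagonal entry dominates its row only if the whole row vanishes, and positive
  scaling neither creates nor removes zeros.\<close>

lemma scaled_diag_dominant_zero_row:
  assumes "finite I" and sdd: "scaled_diag_dominant I Q"
    and "i \<in> I" "j \<in> I" and zero: "Q i i = 0"
  shows "Q i j = 0"
proof (cases "j = i")
  case False
  obtain D where pos: "\<forall>i\<in>I. D i > 0" and dd: "diag_dominant I (\<lambda>i j. D i * Q i j * D j)"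
    using sdd by (auto simp: scaled_diag_dominant_def)
  have "\<bar>D i * Q i j * D j\<bar> \<le> (\<Sum>j\<in>I - {i}. \<bar>D i * Q i j * D j\<bar>)"
    using assms False by (intro member_le_sum) auto
  also have "\<dots> \<le> 0"
    using dd zero \<open>i \<in> I\<close> by (auto simp: diag_dominant_def)
  finally show ?thesis
    using pos \<open>i \<in> I\<close> \<open>j \<in> I\<close> by (auto simp: less_imp_neq[symmetric])
qed (use zero in simp)

text \<open>Serves both for changing the index set and for erasing entries: the diagonal is kept on
  \<open>I \<inter> J\<close>, off-diagonal row sums can only shrink, and rows with index outside
  \<open>I\<close> are zero.\<close>

lemma scaled_diag_dominant_mask:
  assumes "finite I" "finite J" and sdd: "scaled_diag_dominant I Q"
    and supp: "\<And>i j. i \<in> J \<Longrightarrow> j \<in> J \<Longrightarrow> R i j \<noteq> 0 \<Longrightarrow> i \<in> I \<and> j \<in> I \<and> R i j = Q i j"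
    and diag: "\<And>i. i \<in> I \<inter> J \<Longrightarrow> R i i = Q i i"
    and sym: "symmetric_on J R"
  shows "scaled_diag_dominant J R"
proof -
  obtain D where pos: "\<forall>i\<in>I. D i > 0" and dd: "diag_dominant I (\<lambda>i j. D i * Q i j * D j)"
    using sdd by (auto simp: scaled_diag_dominant_def)
  have off: "R i j = 0" if "i \<in> J" "j \<in> J" "\<not> (i \<in> I \<and> j \<in> I)" for i j
    using supp that by blast
  \<comment> \<open>The value 1 is an arbitrary positive choice, since it only scales zero entries
    of \<open>R\<close>.\<close>
  define E where "E i = (if i \<in> I then D i else 1)" for i
  have "(\<Sum>j\<in>J - {i}. \<bar>E i * R i j * E j\<bar>) \<le> E i * R i i * E i" if "i \<in> J" for i
  proof (cases "i \<in> I")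
    case True
    have "(\<Sum>j\<in>J - {i}. \<bar>E i * R i j * E j\<bar>) = (\<Sum>j\<in>J \<inter> I - {i}. \<bar>E i * R i j * E j\<bar>)"
      using off[OF that] \<open>finite J\<close> by (intro sum.mono_neutral_right) auto
    also have "\<dots> \<le> (\<Sum>j\<in>J \<inter> I - {i}. \<bar>D i * Q i j * D j\<bar>)"
    proof (rule sum_mono)
      fix j assume "j \<in> J \<inter> I - {i}"
      then show "\<bar>E i * R i j * E j\<bar> \<le> \<bar>D i * Q i j * D j\<bar>"
        using supp[of i j] that True by (cases "R i j = 0") (auto simp: E_def)
    qed
    also have "\<dots> \<le> (\<Sum>j\<in>I - {i}. \<bar>D i * Q i j * D j\<bar>)"
      using \<open>finite I\<close> by (intro sum_mono2) auto
    also have "\<dots> \<le> D i * Q i i * D i"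
      using dd True by (auto simp: diag_dominant_def)
    finally show ?thesis
      using diag True that by (simp add: E_def)
  next
    case False
    then have "R i j = 0" if "j \<in> J" for j
      using off that \<open>i \<in> J\<close> by blast
    then show ?thesis using \<open>i \<in> J\<close> by simp
  qed
  then have "diag_dominant J (\<lambda>i j. E i * R i j * E j)"
    using sym by (auto simp: diag_dominant_def symmetric_on_def)
  moreover have "\<forall>i\<in>J. E i > 0"
    using pos by (auto simp: E_def)
  ultimately show ?thesis
    using sym by (auto simp: scaled_diag_dominant_def)
qed

section \<open>Gram matrices and Newton polytopes\<close>

lemma lookup_gram_poly:
  "Poly_Mapping.lookup (gram_poly B Q) \<alpha> = (\<Sum>\<beta>\<in>B. \<Sum>\<gamma>\<in>B. if \<beta> + \<gamma> = \<alpha> then Q \<beta> \<gamma> else 0)"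
  by (simp add: gram_poly_def monomial_def const_poly_def mult_single lookup_sum lookup_single when_def)

text \<open>Gram matrices over different index sets become comparable once both coefficient sums run
  over a common \<open>S\<close> that carries all nonzero entries.\<close>

lemma lookup_gram_poly_mono_neutral:
  assumes "finite B" "S \<subseteq> B"
    and "\<And>\<beta> \<gamma>. \<beta> \<in> B \<Longrightarrow> \<gamma> \<in> B \<Longrightarrow> Q \<beta> \<gamma> \<noteq> 0 \<Longrightarrow> \<beta> \<in> S \<and> \<gamma> \<in> S"
  shows "Poly_Mapping.lookup (gram_poly B Q) \<alpha>
    = (\<Sum>\<beta>\<in>S. \<Sum>\<gamma>\<in>S. if \<beta> + \<gamma> = \<alpha> then Q \<beta> \<gamma> else 0)"
proof -
  have zero: "Q \<beta> \<gamma> = 0" if "\<beta> \<in> B" "\<gamma> \<in> B" "\<not> (\<beta> \<in> S \<and> \<gamma> \<in> S)" for \<beta> \<gamma>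
    using assms(3) that by blast
  have "Poly_Mapping.lookup (gram_poly B Q) \<alpha>
      = (\<Sum>\<beta>\<in>S. \<Sum>\<gamma>\<in>B. if \<beta> + \<gamma> = \<alpha> then Q \<beta> \<gamma> else 0)"
    unfolding lookup_gram_poly using assms(1,2) zero
    by (intro sum.mono_neutral_right) (auto intro!: sum.neutral)
  also have "\<dots> = (\<Sum>\<beta>\<in>S. \<Sum>\<gamma>\<in>S. if \<beta> + \<gamma> = \<alpha> then Q \<beta> \<gamma> else 0)"
    using assms(1,2) zero
    by (intro sum.cong refl sum.mono_neutral_right) auto
  finally show ?thesis .
qed

section \<open>Degree bounds and finiteness of monomial bases\<close>

lemma real_expo_add: "real_expo (\<alpha> + \<beta>) = real_expo \<alpha> + real_expo \<beta>"
  by (simp add: real_expo_def vec_eq_iff)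

lemma real_expo_inject: "real_expo \<alpha> = real_expo \<beta> \<longleftrightarrow> \<alpha> = \<beta>"
  by (simp add: real_expo_def vec_eq_iff)

lemma finite_expos_upto: "finite (expos_upto d :: 'n::finite expo set)"
proof -
  have "vec_nth ` (expos_upto d :: 'n expo set) \<subseteq> (UNIV \<rightarrow>\<^sub>E {..d})"
  proof (clarsimp simp: expos_upto_def PiE_def)
    fix \<alpha> :: "'n expo" and i :: 'n
    assume "(\<Sum>i\<in>UNIV. \<alpha> $ i) \<le> d"
    moreover have "\<alpha> $ i \<le> (\<Sum>i\<in>UNIV. \<alpha> $ i)" by (intro member_le_sum) auto
    ultimately show "\<alpha> $ i \<le> d" by simp
  qed
  then have "finite (vec_nth ` (expos_upto d :: 'n expo set))"
    by (rule finite_subset) (simp add: finite_PiE)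
  then show ?thesis
    by (rule finite_imageD) (auto simp: inj_on_def vec_eq_iff)
qed

text \<open>The total degree is the linear functional \<open>1 \<bullet> y\<close>, so its bound on
  \<open>A\<close> passes to the convex hull and is halved by the scaling.\<close>

lemma newton_basis_subset_expos_upto:
  fixes A :: "'n::finite expo set"
  assumes "A \<subseteq> expos_upto (2 * d)"
  shows "newton_basis A \<subseteq> expos_upto d"
proof
  fix \<beta> assume "\<beta> \<in> newton_basis A"
  then obtain x where x: "x \<in> convex hull (real_expo ` A)" and \<beta>: "real_expo \<beta> = (1/2) *\<^sub>R x"
    by (auto simp: newton_basis_def)
  have sum_eq: "(1 :: real ^ 'n) \<bullet> y = (\<Sum>i\<in>UNIV. y $ i)" for y
    by (simp add: inner_vec_def)
  have "convex hull (real_expo ` A) \<subseteq> {y. 1 \<bullet> y \<le> real (2 * d)}"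
  proof (rule hull_minimal)
    show "real_expo ` A \<subseteq> {y. 1 \<bullet> y \<le> real (2 * d)}"
    proof clarify
      fix \<alpha> assume "\<alpha> \<in> A"
      then have "(\<Sum>i\<in>UNIV. \<alpha> $ i) \<le> 2 * d"
        using assms by (auto simp: expos_upto_def)
      then show "1 \<bullet> real_expo \<alpha> \<le> real (2 * d)"
        unfolding sum_eq by (simp add: real_expo_def flip: of_nat_sum)
    qed
  qed (rule convex_halfspace_le)
  then have "1 \<bullet> x \<le> real (2 * d)" using x by blast
  then have "1 \<bullet> real_expo \<beta> \<le> real d" by (simp add: \<beta>)
  then show "\<beta> \<in> expos_upto d"
    unfolding sum_eq by (simp add: real_expo_def expos_upto_def flip: of_nat_sum)
qed

lemma finite_subset_expos_upto:
  fixes A :: "'n::finite expo set"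
  assumes "finite A"
  obtains d where "A \<subseteq> expos_upto (2 * d)"
proof
  show "A \<subseteq> expos_upto (2 * (\<Sum>\<alpha>\<in>A. \<Sum>i\<in>UNIV. \<alpha> $ i))"
  proof
    fix \<alpha> assume "\<alpha> \<in> A"
    then have "(\<Sum>i\<in>UNIV. \<alpha> $ i) \<le> (\<Sum>\<alpha>\<in>A. \<Sum>i\<in>UNIV. \<alpha> $ i)"
      using assms by (intro member_le_sum) auto
    then show "\<alpha> \<in> expos_upto (2 * (\<Sum>\<alpha>\<in>A. \<Sum>i\<in>UNIV. \<alpha> $ i))"
      by (simp add: expos_upto_def)
  qed
qed

lemma monomial_basis_finite:
  assumes "finite A" "monomial_basis A B"
  shows "finite B"
proof -
  obtain d where "A \<subseteq> expos_upto (2 * d)" using finite_subset_expos_upto assms(1) by blast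
  then have "finite (newton_basis A)"
    by (meson newton_basis_subset_expos_upto finite_expos_upto finite_subset)
  then show ?thesis
    using assms(2) finite_expos_upto by (auto simp: monomial_basis_def)
qed

text \<open>Reduces both kinds of monomial basis to the Newton polytope.\<close>

lemma newton_basis_subset_monomial_basis:
  "monomial_basis A B \<Longrightarrow> newton_basis A \<subseteq> B"
  using newton_basis_subset_expos_upto by (auto simp: monomial_basis_def)

section \<open>Diagonal support of a Gram matrix and the Newton polytope\<close>

lemma gram_support_subset_newton_basis:
  fixes Q :: "'n::finite expo \<Rightarrow> 'n expo \<Rightarrow> real"
  assumes "finite I" and supp: "gram_poly I Q \<in> polys_supported A"
    and zero_row: "\<And>i j. i \<in> I \<Longrightarrow> j \<in> I \<Longrightarrow> Q i i = 0 \<Longrightarrow> Q i j = 0 \<and> Q j i = 0"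
  shows "{i \<in> I. Q i i \<noteq> 0} \<subseteq> newton_basis A"
proof -
  define S where "S = {i \<in> I. Q i i \<noteq> 0}"
  define P where "P = convex hull (real_expo ` S)"
  have finS: "finite S" using \<open>finite I\<close> by (simp add: S_def)
  have ext: "x \<in> (\<lambda>x. (1/2) *\<^sub>R x) ` (convex hull (real_expo ` A))"
    if x: "x extreme_point_of P" for x
  proof -
    obtain s where s: "s \<in> S" "x = real_expo s"
      using extreme_point_of_convex_hull x unfolding P_def by blast
    have only_diag: "\<beta> = s \<and> \<gamma> = s" if "\<beta> \<in> S" "\<gamma> \<in> S" "\<beta> + \<gamma> = s + s" for \<beta> \<gamma>
    proof -
      have "real_expo \<beta> + real_expo \<gamma> = 2 *\<^sub>R x"
        using that(3) by (metis real_expo_add s(2) scaleR_2)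
      then have mid: "x = midpoint (real_expo \<beta>) (real_expo \<gamma>)"
        by (simp add: midpoint_def)
      have "real_expo \<beta> \<in> P" "real_expo \<gamma> \<in> P"
        using that by (auto simp: P_def intro: hull_inc)
      then have "x \<notin> open_segment (real_expo \<beta>) (real_expo \<gamma>)"
        using x by (auto simp: extreme_point_of_def)
      \<comment> \<open>The midpoint of two distinct points would lie in their open segment.\<close>
      then have "\<beta> = \<gamma>"
        using mid by (auto simp: real_expo_inject)
      then show ?thesis using mid s by (simp add: real_expo_inject)
    qed
    have "Poly_Mapping.lookup (gram_poly I Q) (s + s)
        = (\<Sum>\<beta>\<in>S. \<Sum>\<gamma>\<in>S. if \<beta> + \<gamma> = s + s then Q \<beta> \<gamma> else 0)"
      using \<open>finite I\<close> by (rule lookup_gram_poly_mono_neutral) (use zero_row in \<open>unfold S_def, blast+\<close>)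
    also have "\<dots> = (\<Sum>\<beta>\<in>S. if \<beta> = s then Q s s else 0)"
    proof (rule sum.cong[OF refl])
      fix \<beta> assume "\<beta> \<in> S"
      have "(\<Sum>\<gamma>\<in>S. if \<beta> + \<gamma> = s + s then Q \<beta> \<gamma> else 0)
          = (\<Sum>\<gamma>\<in>S. if \<gamma> = s then (if \<beta> = s then Q s s else 0) else 0)"
      proof (rule sum.cong[OF refl])
        fix \<gamma> assume "\<gamma> \<in> S"
        have "\<beta> + \<gamma> = s + s \<longleftrightarrow> \<beta> = s \<and> \<gamma> = s"
          using only_diag \<open>\<beta> \<in> S\<close> \<open>\<gamma> \<in> S\<close> by blast
        then show "(if \<beta> + \<gamma> = s + s then Q \<beta> \<gamma> else 0)
            = (if \<gamma> = s then (if \<beta> = s then Q s s else 0) else 0)"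
          by simp
      qed
      then show "(\<Sum>\<gamma>\<in>S. if \<beta> + \<gamma> = s + s then Q \<beta> \<gamma> else 0) = (if \<beta> = s then Q s s else 0)"
        using finS s by simp
    qed
    also have "\<dots> = Q s s" using finS s by simp
    finally have "s + s \<in> Poly_Mapping.keys (gram_poly I Q)"
      using s by (simp add: S_def in_keys_iff)
    then have "s + s \<in> A" using supp by (auto simp: polys_supported_def)
    then have "real_expo (s + s) \<in> convex hull (real_expo ` A)" by (auto intro: hull_inc)
    moreover have "x = (1/2) *\<^sub>R real_expo (s + s)"
      by (simp add: s real_expo_add flip: scaleR_2)
    ultimately show ?thesis by blast
  qed
  have "P = convex hull {x. x extreme_point_of P}"
    unfolding P_def using finS
    by (intro Krein_Milman_Minkowski compact_convex_hull finite_imp_compact finite_imageI convex_convex_hull)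
  \<comment> \<open>The halved hull is convex, so it suffices that it contains the extreme
    points.\<close>
  also have "\<dots> \<subseteq> (\<lambda>x. (1/2) *\<^sub>R x) ` (convex hull (real_expo ` A))"
    using ext by (intro hull_minimal) (auto intro: convex_scaling)
  finally show ?thesis
    unfolding S_def[symmetric] newton_basis_def P_def by (auto intro: hull_inc)
qed

section \<open>Transfer of the Gram matrix to the monomial basis\<close>

theorem theorem4p3:
  fixes A B :: "(nat ^ 'n::finite) set"
  assumes "finite A"
    and "monomial_basis A B"
  shows "SDSOS A B \<subseteq> Sigma1_sos A B"
proof
  fix f assume "f \<in> SDSOS A B"
  then obtain d Q where suppA: "f \<in> polys_supported A"
    and sdd: "scaled_diag_dominant (expos_upto d) Q" and f: "f = gram_poly (expos_upto d) Q"
    by (auto simp: SDSOS_def Sigma_sos_def sdsos_poly_def)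
  define I :: "'n expo set" where "I = expos_upto d"
  define S where "S = {i \<in> I. Q i i \<noteq> 0}"
  define C where "C = A \<union> (\<lambda>\<delta>. 2 *s \<delta>) ` B"
  \<comment> \<open>The degree \<open>d\<close> is unrelated to \<open>B\<close>, so
    \<open>B\<close> may contain exponents outside \<open>I\<close>, where nothing is known about
    \<open>Q\<close>. The restriction to \<open>S\<close> puts zeros there.\<close>
  define R where "R \<beta> \<gamma> = (if \<beta> \<in> S \<and> \<gamma> \<in> S \<and> \<beta> + \<gamma> \<in> C then Q \<beta> \<gamma> else 0)" for \<beta> \<gamma>
  note sdd = sdd[folded I_def] and f = f[folded I_def]
  have finI: "finite I" by (simp add: I_def finite_expos_upto)
  have finB: "finite B" using monomial_basis_finite assms .
  have symQ: "Q i j = Q j i" if "i \<in> I" "j \<in> I" for i j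
    using sdd that by (auto simp: scaled_diag_dominant_def symmetric_on_def)
  have zero_row: "Q i j = 0 \<and> Q j i = 0" if "i \<in> I" "j \<in> I" "Q i i = 0" for i j
    using scaled_diag_dominant_zero_row[OF finI sdd] symQ that by metis
  have SB: "S \<subseteq> B"
    unfolding S_def
    by (rule order_trans[OF gram_support_subset_newton_basis[OF finI suppA[unfolded f] zero_row]
      newton_basis_subset_monomial_basis[OF assms(2)]])
  \<comment> \<open>The doubled exponents in \<open>C\<close> protect the diagonal from the mask, as
    dominance of \<open>R\<close> requires.\<close>
  have double: "\<beta> + \<beta> \<in> C" if "\<beta> \<in> B" for \<beta>
  proof -
    have "\<beta> + \<beta> = 2 *s \<beta>" by (simp add: vec_eq_iff)
    then show ?thesis using that by (auto simp: C_def)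
  qed
  have symR: "symmetric_on B R"
    by (auto simp: symmetric_on_def R_def S_def symQ add.commute)
  have "R i i = Q i i" if "i \<in> I \<inter> B" for i
    using that double by (auto simp: R_def S_def)
  then have "scaled_diag_dominant B R"
    by (intro scaled_diag_dominant_mask[OF finI finB sdd _ _ symR])
      (auto simp: R_def S_def split: if_splits)
  then have "R \<in> psd_matrices B"
    using finB by (rule scaled_diag_dominant_imp_psd[rotated])
  moreover have "block_closure B (tsp_matrix A B) i j * R i j = R i j" if "i \<in> B" "j \<in> B" for i j
  proof (cases "i + j \<in> C")
    case True
    \<comment> \<open>\<open>R\<close> already respects the pattern before closure, so a single step
      of the relation is enough.\<close>
    then have "(i, j) \<in> {(k, l). k \<in> B \<and> l \<in> B \<and> tsp_matrix A B k l = 1}\<^sup>+"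
      using that by (intro r_into_trancl) (auto simp: tsp_matrix_def C_def)
    then show ?thesis by (simp add: block_closure_def)
  qed (simp add: R_def)
  moreover have "f = gram_poly B R"
  proof (rule poly_mapping_eqI)
    fix \<alpha>
    have R: "Poly_Mapping.lookup (gram_poly B R) \<alpha>
        = (\<Sum>\<beta>\<in>S. \<Sum>\<gamma>\<in>S. if \<beta> + \<gamma> = \<alpha> then R \<beta> \<gamma> else 0)"
      using finB SB by (rule lookup_gram_poly_mono_neutral) (auto simp: R_def split: if_splits)
    have Q: "Poly_Mapping.lookup f \<alpha> = (\<Sum>\<beta>\<in>S. \<Sum>\<gamma>\<in>S. if \<beta> + \<gamma> = \<alpha> then Q \<beta> \<gamma> else 0)"
      unfolding f using finI
      by (rule lookup_gram_poly_mono_neutral) (use zero_row in \<open>unfold S_def, blast+\<close>)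
    show "Poly_Mapping.lookup f \<alpha> = Poly_Mapping.lookup (gram_poly B R) \<alpha>"
    \<comment> \<open>For \<open>\<alpha>\<close> in \<open>C\<close> the mask erases no pair of
      \<open>S\<close> with sum \<open>\<alpha>\<close>. Otherwise it erases all of them, and the
      coefficient of \<open>f\<close> is zero because \<open>A \<subseteq> C\<close>.\<close>
    proof (cases "\<alpha> \<in> C")
      case True
      then show ?thesis unfolding Q R by (intro sum.cong) (auto simp: R_def)
    next
      case False
      then have "Poly_Mapping.lookup f \<alpha> = 0"
        using suppA by (auto simp: polys_supported_def C_def in_keys_iff)
      moreover have "Poly_Mapping.lookup (gram_poly B R) \<alpha> = 0"
        unfolding R using False by (auto simp: R_def intro!: sum.neutral)
      ultimately show ?thesis by simp
    qed
  qed
  ultimately show "f \<in> Sigma1_sos A B"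
    using suppA by (auto simp: Sigma1_sos_def psd_matrices_pattern_def)
qed

end
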